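(* Let $n\ge 1$ and let $a_1,\dots,a_n$ be integers with $a_m\ge 2$ for all $m$. Then the sandpile group of $Ch_n(a_1,\dots,a_n)$ is cyclic of order $F_n(a_1,\dots,a_n)$, which also equals $G_n(a_1,\dots,a_n)$: $S(Ch_n(a_1,\dots,a_n))\cong C_{F_n(a_1,\dots,a_n)}\cong C_{G_n(a_1,\dots,a_n)}$.
   Context: $Ch_n(a_1,\dots,a_n)$ is the following multigraph ("chain" of $n$ cycles of lengths $a_1,\dots,a_n$, each consecutive pair sharing an edge, all cycles sharing a common vertex). Let $s_0=1$ and $s_j=1+\sum_{m=1}^{j}(a_m-2)$ for $1\le j\le n$, and $k=s_n$. The vertices are $u_1,\dots,u_k$ and a center $c$; the edges are the path edges $u_1u_2,u_2u_3,\dots,u_{k-1}u_k$ together with, for each $j=0,1,\dots,n$, one edge $c\,u_{s_j}$ (so if $s_j=s_{j'}$ for $j\ne j'$, there are multiple edges between $c$ and $u_{s_j}$). Then for each $j$ the vertices $c,u_{s_{j-1}},\dots,u_{s_j}$ form a cycle of length $a_j$. For a finite multigraph $X$ with Laplacian matrix $L$ (diagonal entries the vertex degrees, off-diagonal entry $(u,v)$ equal to minus the number of edges between $u$ and $v$), the sandpile group is $S(X)\cong\bigoplus_a C_{|a|}$ over the nonzero diagonal entries $a$ of the Smith normal form of $L$; $C_m$ is the cyclic group of order $m$. $F_n$ is defined recursively by $F_1(x_1)=x_1$ and $F_{i+1}(x_1,\dots,x_{i+1})=F_i(x_1,\dots,x_{i-1},x_i-1)+(x_{i+1}-1)F_i(x_1,\dots,x_i)$.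 For non-negative integers $i,j$, $C_{i,j}$ is the set of subsets $I\subseteq\{1,\dots,j\}$ with $|I|=i$ such that consecutive elements of $I$ differ by an odd number and $j-\max(I)$ is even (with $\max(\emptyset)=0$); $\gamma_{i,j}(x_1,\dots,x_j)=\sum_{I\in C_{i,j}}\prod_{m\in I}x_m$; and $G_n=\sum_{0\le m\le n/2}(-1)^m\gamma_{n-2m,n}$. *)

theory Defs
  imports
    "HOL-Library.Multiset"
    "HOL-Algebra.Elementary_Groups"
    "HOL-Algebra.Product_Groups"
    "Jordan_Normal_Form.Matrix"
begin

section \<open>Multigraphs and sandpile groups\<close>

text \<open>An edge is the set of its two end points; the multiplicity of an edge is its multiplicity
  in the multiset.\<close>

record 'v multigraph =
  verts :: "'v set"
  edges :: "'v set multiset"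

definition finite_multigraph :: "'v multigraph \<Rightarrow> bool" where
  "finite_multigraph X \<longleftrightarrow>
     finite (verts X) \<and> (\<forall>e \<in># edges X. e \<subseteq> verts X \<and> card e = 2)"

definition degree :: "'v multigraph \<Rightarrow> 'v \<Rightarrow> nat" where
  "degree X v = size {#e \<in># edges X. v \<in> e#}"

text \<open>Rows and columns follow the linear order of the vertices. Another enumeration only changes
  the matrix by a simultaneous permutation of rows and columns, which does not affect its
  Smith normal forms.\<close>

definition laplacian :: "('v::linorder) multigraph \<Rightarrow> int mat" where
  "laplacian X =
     (let vs = sorted_list_of_set (verts X)
      in mat (length vs) (length vs)
           (\<lambda>(i, j). if i = j then int (degree X (vs ! i))
                     else - int (count (edges X) {vs ! i, vs ! j})))"

text \<open>The diagonal entries are not normalised to be non-negative, so a Smith normal form is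
  unique only up to the signs of its entries.\<close>

definition smith_normal_form_of :: "int mat \<Rightarrow> int mat \<Rightarrow> bool" where
  "smith_normal_form_of A D \<longleftrightarrow>
     (\<exists>P Q. P \<in> carrier_mat (dim_row A) (dim_row A) \<and> invertible_mat P \<and>
            Q \<in> carrier_mat (dim_col A) (dim_col A) \<and> invertible_mat Q \<and>
            D = P * A * Q) \<and>
     diagonal_mat D \<and>
     (\<forall>i. Suc i < min (dim_row D) (dim_col D) \<longrightarrow> D $$ (i, i) dvd D $$ (Suc i, Suc i))"

definition sandpile_group :: "('v::linorder) multigraph \<Rightarrow> (nat \<Rightarrow> int) monoid" where
  "sandpile_group X =
     (let D = (SOME D. smith_normal_form_of (laplacian X) D)
      in sum_group {i. i < dim_row D \<and> D $$ (i, i) \<noteq> 0}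
           (\<lambda>i. integer_mod_group (nat \<bar>D $$ (i, i)\<bar>)))"


section \<open>Chains of cycles\<close>

definition chain_pos :: "(nat \<Rightarrow> int) \<Rightarrow> nat \<Rightarrow> int" where
  "chain_pos a j = 1 + (\<Sum>m = 1..j. a m - 2)"

text \<open>The center is the vertex \<open>0\<close>, and \<open>u\<^sub>i\<close> is the vertex \<open>i\<close> for \<open>1 \<le> i \<le> k = chain_pos a n\<close>.\<close>

definition chain :: "nat \<Rightarrow> (nat \<Rightarrow> int) \<Rightarrow> int multigraph" where
  "chain n a =
     \<lparr> verts = {0} \<union> {1..chain_pos a n},
       edges = image_mset (\<lambda>i. {i, i + 1}) (mset_set {1..<chain_pos a n})
             + image_mset (\<lambda>j. {0, chain_pos a j}) (mset_set {0..n}) \<rparr>"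

lemma chain_pos_mono:
  assumes "\<And>m. 1 \<le> m \<Longrightarrow> m \<le> n \<Longrightarrow> 2 \<le> a m" "i \<le> j" "j \<le> n"
  shows "chain_pos a i \<le> chain_pos a j"
  unfolding chain_pos_def
  using assms by (intro add_left_mono sum_mono2) auto

lemma finite_multigraph_chain:
  assumes "\<And>m. 1 \<le> m \<Longrightarrow> m \<le> n \<Longrightarrow> 2 \<le> a m"
  shows "finite_multigraph (chain n a)"
proof -
  have "1 \<le> chain_pos a j" "chain_pos a j \<le> chain_pos a n" if "j \<le> n" for j
    using chain_pos_mono[of n a 0 j] chain_pos_mono[of n a j n] assms that
    by (auto simp: chain_pos_def[of a 0])
  then show ?thesis
    by (fastforce simp: finite_multigraph_def chain_def card_insert_if)
qed


section \<open>The polynomials \<open>F\<^sub>n\<close> and \<open>G\<^sub>n\<close>\<close>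

text \<open>The value at \<open>n = 0\<close> is a dummy: \<open>F\<^sub>n\<close> is only meant for \<open>n \<ge> 1\<close>.\<close>

fun F :: "nat \<Rightarrow> (nat \<Rightarrow> int) \<Rightarrow> int" where
  "F 0 x = 1"
| "F (Suc 0) x = x 1"
| "F (Suc (Suc i)) x =
     F (Suc i) (x(Suc i := x (Suc i) - 1)) + (x (Suc (Suc i)) - 1) * F (Suc i) x"

definition consecutive_in :: "nat set \<Rightarrow> nat \<Rightarrow> nat \<Rightarrow> bool" where
  "consecutive_in I p q \<longleftrightarrow> p \<in> I \<and> q \<in> I \<and> p < q \<and> \<not> (\<exists>r\<in>I. p < r \<and> r < q)"

definition C :: "nat \<Rightarrow> nat \<Rightarrow> nat set set" where
  "C i j = {I. I \<subseteq> {1..j} \<and> card I = i \<and>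
               (\<forall>p q. consecutive_in I p q \<longrightarrow> odd (q - p)) \<and>
               even (j - (if I = {} then 0 else Max I))}"

definition \<gamma> :: "nat \<Rightarrow> nat \<Rightarrow> (nat \<Rightarrow> int) \<Rightarrow> int" where
  "\<gamma> i j x = (\<Sum>I\<in>C i j. \<Prod>m\<in>I. x m)"

definition G :: "nat \<Rightarrow> (nat \<Rightarrow> int) \<Rightarrow> int" where
  "G n x = (\<Sum>m | 2 * m \<le> n. (-1) ^ m * \<gamma> (n - 2 * m) n x)"

end

theory Submission
  imports Defs "Jordan_Normal_Form.Determinant"
begin

text \<open>Both \<open>F\<close> and \<open>G\<close> satisfy the continuant recurrence
  \<open>K\<^sub>n = x\<^sub>n K\<^bsub>n-1\<^esub> - K\<^bsub>n-2\<^esub>\<close>, for \<open>G\<close> by splitting the index sets according to whether they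
  contain \<open>n\<close>.

  Since consecutive path vertices are joined by a single edge, a function on the vertices that is
  harmonic at \<open>u\<^sub>1, \<dots>, u\<^bsub>k-1\<^esub>\<close> is determined by its values at the center and at \<open>u\<^sub>1\<close>. For the
  values \<open>0\<close> and \<open>1\<close> this potential has slope \<open>F\<^sub>j\<close> behind the spoke \<open>j\<close>, so the Laplacian maps it
  to \<open>F\<^sub>n (u\<^sub>k - c)\<close>; it kills the constants, and it maps \<open>u\<^sub>2, \<dots>, u\<^sub>k\<close> to vectors that form a
  basis together with \<open>u\<^sub>k - c\<close> and \<open>c\<close>. This gives the Smith normal form \<open>diag(1, \<dots>, 1, F\<^sub>n, 0)\<close>.

  Any other Smith normal form has the same diagonal up to signs, because the number of solutions of
  \<open>A x = 0\<close> modulo \<open>m\<close> is invariant under equivalence and equals \<open>\<Prod>i. gcd d\<^sub>i m\<close> for a diagonal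
  matrix.\<close>

section \<open>The polynomials\<close>

text \<open>Discards the update at a higher index that remains when the recursion of
  \<open>F\<close> is unfolded on a modified argument.\<close>

lemma F_fun_upd_greater: "n < p \<Longrightarrow> F n (x(p := v)) = F n x"
proof (induction n x rule: F.induct)
  case (3 i x)
  have "x(p := v, Suc i := x (Suc i) - 1) = x(Suc i := x (Suc i) - 1, p := v)"
    using 3(3) by (intro fun_upd_twist) simp
  moreover have "(x(p := v)) (Suc i) = x (Suc i)" "(x(p := v)) (Suc (Suc i)) = x (Suc (Suc i))"
    using 3(3) by auto
  ultimately show ?case using 3 by (simp del: fun_upd_apply)
qed auto

text \<open>\<open>F (Suc n)\<close> is affine in its last variable with slope \<open>F n\<close>.
  For \<open>n = 0\<close> this relies on the dummy value \<open>F 0 x = 1\<close>.\<close>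

lemma F_decrease_last: "F (Suc n) (x(Suc n := x (Suc n) - 1)) = F (Suc n) x - F n x"
proof (cases n)
  case (Suc i)
  have "x(Suc (Suc i) := v, Suc i := w) = x(Suc i := w, Suc (Suc i) := v)" for v w
    by (intro fun_upd_twist) simp
  with Suc show ?thesis by (simp add: F_fun_upd_greater algebra_simps)
qed simp

lemma F_rec: "F (Suc (Suc n)) x = x (Suc (Suc n)) * F (Suc n) x - F n x"
  by (simp add: F_decrease_last algebra_simps)

text \<open>Positivity alone does not carry the induction because the recurrence subtracts
  \<open>F n\<close>; with monotonicity, x F_{n+1} - F_n is at least 2 F_{n+1} - F_n, hence at least
  F_{n+1}.\<close>

lemma F_increasing_pos:
  assumes "\<And>m. 1 \<le> m \<Longrightarrow> m \<le> Suc n \<Longrightarrow> 2 \<le> x m"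
  shows "0 < F n x \<and> F n x \<le> F (Suc n) x"
  using assms
proof (induction n)
  case 0
  then show ?case using "0"[of 1] by simp
next
  case (Suc n)
  have IH: "0 < F n x" "F n x \<le> F (Suc n) x"
    using Suc by auto
  have "2 * F (Suc n) x \<le> x (Suc (Suc n)) * F (Suc n) x"
    using IH Suc.prems by (intro mult_right_mono) auto
  with IH show ?case by (simp only: F_rec) linarith
qed

lemma F_pos:
  assumes "\<And>m. 1 \<le> m \<Longrightarrow> m \<le> n \<Longrightarrow> 2 \<le> x m"
  shows "0 < F n x"
proof (cases n)
  case (Suc n')
  with F_increasing_pos[of n' x] assms show ?thesis by fastforce
qed simp

section \<open>Splitting the index sets of \<open>G\<close> by their top element\<close>

definition alternating_subsets :: "nat \<Rightarrow> nat set set" where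
  "alternating_subsets n = {I. I \<subseteq> {1..n} \<and> even (n + card I) \<and>
     (\<forall>p q. consecutive_in I p q \<longrightarrow> odd (q - p)) \<and> (I \<noteq> {} \<longrightarrow> even (n - Max I))}"

lemma finite_alternating_subsets: "finite (alternating_subsets n)"
  by (rule finite_subset[of _ "Pow {1..n}"]) (auto simp: alternating_subsets_def)

lemma alternating_subsetsD:
  assumes "I \<in> alternating_subsets n"
  shows "I \<subseteq> {1..n}" "finite I" "card I \<le> n"
proof -
  show "I \<subseteq> {1..n}" using assms by (simp add: alternating_subsets_def)
  then show "finite I" "card I \<le> n"
    using finite_subset card_mono[of "{1..n}" I] by auto
qed

lemma finite_C: "finite (C i j)"
  by (rule finite_subset[of _ "Pow {1..j}"]) (auto simp: C_def)

text \<open>Evenness of \<open>n + card I\<close> says that \<open>card I\<close> has the form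
  \<open>n - 2 * m\<close>. For \<open>I = {}\<close> it also yields the condition that
  \<open>C\<close> imposes through the convention max({}) = 0.\<close>

lemma alternating_subsets_eq_UN_C:
  "alternating_subsets n = (\<Union>m\<in>{m. 2 * m \<le> n}. C (n - 2 * m) n)"
proof (intro equalityI subsetI)
  fix I assume I: "I \<in> alternating_subsets n"
  note le = alternating_subsetsD(3)[OF I]
  have "even (n - card I)" using I le by (auto simp: alternating_subsets_def)
  then have "n - 2 * ((n - card I) div 2) = card I" "2 * ((n - card I) div 2) \<le> n"
    using le by auto
  with I show "I \<in> (\<Union>m\<in>{m. 2 * m \<le> n}. C (n - 2 * m) n)"
    by (intro UN_I[of "(n - card I) div 2"]) (auto simp: alternating_subsets_def C_def)
qed (auto simp: alternating_subsets_def C_def split: if_splits)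

text \<open>The cardinality of \<open>I\<close> determines \<open>m\<close>, so the families are
  disjoint and the sign can be read off from \<open>I\<close>.\<close>

lemma G_eq_sum_alternating_subsets:
  "G n x = (\<Sum>I\<in>alternating_subsets n. (-1) ^ ((n - card I) div 2) * (\<Prod>m\<in>I. x m))"
proof -
  have fin: "finite {m. 2 * m \<le> n}"
    by (rule finite_subset[of _ "{..n}"]) auto
  have "G n x = (\<Sum>m | 2 * m \<le> n. \<Sum>I\<in>C (n - 2 * m) n.
      (-1) ^ ((n - card I) div 2) * (\<Prod>m\<in>I. x m))"
    unfolding G_def \<gamma>_def sum_distrib_left
    by (intro sum.cong refl) (auto simp: C_def)
  also have "\<dots> = (\<Sum>I\<in>alternating_subsets n. (-1) ^ ((n - card I) div 2) * (\<Prod>m\<in>I. x m))"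
    unfolding alternating_subsets_eq_UN_C
  proof (rule sum.UNION_disjoint[symmetric, OF fin])
    show "\<forall>i\<in>{m. 2 * m \<le> n}. \<forall>j\<in>{m. 2 * m \<le> n}. i \<noteq> j \<longrightarrow> C (n - 2 * i) n \<inter> C (n - 2 * j) n = {}"
    proof (intro ballI impI)
      fix i j assume "i \<in> {m. 2 * m \<le> n}" "j \<in> {m. 2 * m \<le> n}" "i \<noteq> j"
      then have "n - 2 * i \<noteq> n - 2 * j" by auto
      moreover have "card I = l" if "I \<in> C l n" for I l using that by (simp add: C_def)
      ultimately show "C (n - 2 * i) n \<inter> C (n - 2 * j) n = {}" by (metis disjoint_iff)
    qed
  qed (simp add: finite_C)
  finally show ?thesis .
qed

lemma consecutive_in_insert_top:
  assumes "I \<subseteq> {..n}"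
  shows "consecutive_in (insert (Suc n) I) p q \<longleftrightarrow>
    consecutive_in I p q \<or> (I \<noteq> {} \<and> p = Max I \<and> q = Suc n)"
proof -
  have fin: "finite I" using assms finite_subset by blast
  have "consecutive_in (insert (Suc n) I) p q \<longleftrightarrow> consecutive_in I p q" if "q \<noteq> Suc n"
    using that assms by (fastforce simp: consecutive_in_def)
  moreover have "consecutive_in (insert (Suc n) I) p (Suc n) \<longleftrightarrow> I \<noteq> {} \<and> p = Max I"
  proof
    assume l: "consecutive_in (insert (Suc n) I) p (Suc n)"
    then have "p \<in> I" by (auto simp: consecutive_in_def)
    moreover have "r \<le> p" if "r \<in> I" for r
      using l that assms by (force simp: consecutive_in_def not_less)
    ultimately show "I \<noteq> {} \<and> p = Max I" using fin by (auto intro: Max_eqI[symmetric])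
  next
    assume r: "I \<noteq> {} \<and> p = Max I"
    then have "p \<in> I" "\<And>r. r \<in> I \<Longrightarrow> r \<le> p" using fin by auto
    then show "consecutive_in (insert (Suc n) I) p (Suc n)"
      using assms by (fastforce simp: consecutive_in_def)
  qed
  moreover have "\<not> consecutive_in I p (Suc n)"
    using assms by (auto simp: consecutive_in_def)
  ultimately show ?thesis by blast
qed

text \<open>The only new consecutive pair is \<open>(Max I, Suc n)\<close>, and its gap is odd
  exactly when \<open>n - Max I\<close> is even; the new maximum has distance 0 from the
  top.\<close>

lemma insert_top_alternating_subsets_iff:
  assumes "I \<subseteq> {1..n}"
  shows "insert (Suc n) I \<in> alternating_subsets (Suc n) \<longleftrightarrow> I \<in> alternating_subsets n"
proof -
  have fin: "finite I" using assms finite_subset by blast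
  have top: "Suc n \<notin> I" "I \<subseteq> {..n}" using assms by auto
  have "Max (insert (Suc n) I) = Suc n"
    using top fin by (intro Max_eqI) auto
  moreover have "odd (Suc n - Max I) \<longleftrightarrow> even (n - Max I)" if "I \<noteq> {}"
  proof -
    have "Max I \<le> n" using that fin top by auto
    then show ?thesis by (simp add: Suc_diff_le)
  qed
  ultimately show ?thesis
    using assms top fin
    by (auto simp: alternating_subsets_def consecutive_in_insert_top card_insert_if)
qed

text \<open>A set that omits n+2 omits n+1 too, since otherwise its maximum would be at odd distance
  from n+2. Lowering the bound by 2 then preserves all parities.\<close>

lemma alternating_subsets_without_top:
  "{I \<in> alternating_subsets (Suc (Suc n)). Suc (Suc n) \<notin> I} = alternating_subsets n"
proof (intro equalityI subsetI)
  fix I assume "I \<in> {I \<in> alternating_subsets (Suc (Suc n)). Suc (Suc n) \<notin> I}"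
  then have I: "I \<in> alternating_subsets (Suc (Suc n))" "Suc (Suc n) \<notin> I" by auto
  note sub = alternating_subsetsD(1)[OF I(1)] and fin = alternating_subsetsD(2)[OF I(1)]
  have sub': "i \<le> Suc n" if "i \<in> I" for i
    using that sub I(2) by (metis atLeastAtMost_iff le_SucE subsetD)
  have "Suc n \<notin> I"
  proof
    assume n: "Suc n \<in> I"
    then have "Max I = Suc n" using sub' fin by (intro Max_eqI) auto
    with I n show False by (auto simp: alternating_subsets_def)
  qed
  with sub sub' have sub: "I \<subseteq> {1..n}"
    by (metis atLeastAtMost_iff le_Suc_eq subset_iff)
  have "Max I \<le> n" if "I \<noteq> {}" using sub that fin by auto
  with I sub show "I \<in> alternating_subsets n"
    by (cases "I = {}") (auto simp: alternating_subsets_def Suc_diff_le)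
next
  fix I assume I: "I \<in> alternating_subsets n"
  note sub = alternating_subsetsD(1)[OF I] and fin = alternating_subsetsD(2)[OF I]
  have "Max I \<le> n" if "I \<noteq> {}" using sub that fin by auto
  moreover have "I \<subseteq> {1..Suc (Suc n)}" "Suc (Suc n) \<notin> I" using sub by auto
  ultimately show "I \<in> {I \<in> alternating_subsets (Suc (Suc n)). Suc (Suc n) \<notin> I}"
    using I by (cases "I = {}") (auto simp: alternating_subsets_def Suc_diff_le)
qed

lemma alternating_subsets_with_top:
  "{I \<in> alternating_subsets (Suc n). Suc n \<in> I} = insert (Suc n) ` alternating_subsets n"
proof (intro equalityI subsetI)
  fix I assume I: "I \<in> {I \<in> alternating_subsets (Suc n). Suc n \<in> I}"
  then have eq: "insert (Suc n) (I - {Suc n}) = I" by auto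
  moreover have sub: "I - {Suc n} \<subseteq> {1..n}"
    using I alternating_subsetsD(1)[of I "Suc n"] by auto
  ultimately have "I - {Suc n} \<in> alternating_subsets n"
    using insert_top_alternating_subsets_iff[OF sub] I by simp
  with eq show "I \<in> insert (Suc n) ` alternating_subsets n" by blast
next
  fix I assume "I \<in> insert (Suc n) ` alternating_subsets n"
  then obtain J where J: "J \<in> alternating_subsets n" "I = insert (Suc n) J" by blast
  then have "J \<subseteq> {1..n}" by (auto simp: alternating_subsets_def)
  with J insert_top_alternating_subsets_iff[of J n]
  show "I \<in> {I \<in> alternating_subsets (Suc n). Suc n \<in> I}" by simp
qed

lemma G_rec: "G (Suc (Suc n)) x = x (Suc (Suc n)) * G (Suc n) x - G n x"
proof -
  let ?N = "Suc (Suc n)"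
  let ?t = "\<lambda>n I. (-1) ^ ((n - card I) div 2) * (\<Prod>m\<in>I. x m)"
  have "G ?N x = sum (?t ?N) ({I \<in> alternating_subsets ?N. ?N \<in> I} \<union>
      {I \<in> alternating_subsets ?N. ?N \<notin> I})"
    unfolding G_eq_sum_alternating_subsets by (rule sum.cong) auto
  also have "\<dots> = sum (?t ?N) {I \<in> alternating_subsets ?N. ?N \<in> I} +
      sum (?t ?N) {I \<in> alternating_subsets ?N. ?N \<notin> I}"
    by (rule sum.union_disjoint) (auto simp: finite_alternating_subsets)
  also have "\<dots> = sum (?t ?N) (insert ?N ` alternating_subsets (Suc n)) +
      sum (?t ?N) (alternating_subsets n)"
    by (simp only: alternating_subsets_with_top alternating_subsets_without_top)
  \<comment> \<open>Bound and cardinality both grow by one, so the sign stays and only the factor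
    \<open>x ?N\<close> is new.\<close>
  also have "sum (?t ?N) (insert ?N ` alternating_subsets (Suc n)) = x ?N * G (Suc n) x"
  proof -
    have notin: "?N \<notin> I" if "I \<in> alternating_subsets (Suc n)" for I
      using alternating_subsetsD(1)[OF that] by auto
    have "inj_on (insert ?N) (alternating_subsets (Suc n))"
      using notin by (intro inj_onI) (metis insert_ident)
    then show ?thesis
      unfolding G_eq_sum_alternating_subsets sum_distrib_left
      by (subst sum.reindex) (auto intro!: sum.cong simp: notin alternating_subsetsD(2))
  qed
  \<comment> \<open>The bound drops by 2 at equal cardinality, which flips the sign.\<close>
  also have "sum (?t ?N) (alternating_subsets n) = - G n x"
    unfolding G_eq_sum_alternating_subsets sum_negf[symmetric]
  proof (rule sum.cong[OF refl])
    fix I assume I: "I \<in> alternating_subsets n"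
    then have "card I \<le> n" by (rule alternating_subsetsD)
    then have "(?N - card I) div 2 = Suc ((n - card I) div 2)" by (simp add: Suc_diff_le)
    then show "?t ?N I = - ?t n I" by simp
  qed
  finally show ?thesis by simp
qed

lemma F_eq_G: "F n x = G n x"
proof (induction n rule: induct_nat_012)
  case 0
  have "alternating_subsets 0 = {{}}"
    by (auto simp: alternating_subsets_def consecutive_in_def)
  then show ?case by (simp add: G_eq_sum_alternating_subsets)
next
  case 1
  have "alternating_subsets 1 = {{1}}"
    by (auto simp: alternating_subsets_def consecutive_in_def subset_singleton_iff)
  then show ?case by (simp add: G_eq_sum_alternating_subsets)
next
  case (ge2 n)
  then show ?case by (simp only: F_rec G_rec)
qed


section \<open>Uniqueness of the Smith normal form\<close>

text \<open>With g = gcd(d, m) and m = m' g, the solutions are the multiples of m', and g of them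
  lie in [0, m).\<close>

lemma card_annihilated_mod:
  fixes d m :: int
  assumes "m > 0"
  shows "int (card {x \<in> {0..<m}. m dvd d * x}) = gcd d m"
proof -
  define g where "g = gcd d m"
  have g: "g > 0" using assms by (simp add: g_def)
  obtain d' m' where dm: "d = d' * g" "m = m' * g" "coprime d' m'"
    using gcd_coprime_exists[of d m] assms unfolding g_def by auto
  have m': "m' > 0" using dm(2) g assms by (simp add: zero_less_mult_iff)
  have dvd: "m dvd d * x \<longleftrightarrow> m' dvd x" for x
  proof -
    have "m dvd d * x \<longleftrightarrow> g * m' dvd g * (d' * x)" by (simp add: dm mult_ac)
    also have "\<dots> \<longleftrightarrow> m' dvd d' * x" using g by simp
    also have "\<dots> \<longleftrightarrow> m' dvd x"
      using dm(3) by (simp add: coprime_commute coprime_dvd_mult_right_iff)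
    finally show ?thesis .
  qed
  have "{x \<in> {0..<m}. m dvd d * x} = (*) m' ` {0..<g}"
  proof (intro equalityI subsetI)
    fix x assume "x \<in> {x \<in> {0..<m}. m dvd d * x}"
    then obtain t where t: "x = m' * t" "0 \<le> x" "x < m" by (auto simp: dvd)
    then have "t \<in> {0..<g}" using m' by (simp add: dm(2) zero_le_mult_iff)
    with t show "x \<in> (*) m' ` {0..<g}" by blast
  next
    fix x assume "x \<in> (*) m' ` {0..<g}"
    then have "m' dvd x" "0 \<le> x" "x < m" using m' by (auto simp: dm(2))
    then show "x \<in> {x \<in> {0..<m}. m dvd d * x}" by (simp add: dvd)
  qed
  moreover have "inj_on ((*) m') {0..<g}" using m' by (auto simp: inj_on_def)
  ultimately show ?thesis using g by (simp add: card_image g_def)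
qed

text \<open>The kernel of \<open>A\<close> over the integers modulo \<open>m\<close>, with each
  class represented by its vector of residues in \<open>{0..<m}\<close>.\<close>

definition mod_kernel :: "int \<Rightarrow> int mat \<Rightarrow> int vec set" where
  "mod_kernel m A = {x \<in> carrier_vec (dim_col A). (\<forall>i < dim_col A. x $ i \<in> {0..<m}) \<and>
     (\<forall>i < dim_row A. m dvd (A *\<^sub>v x) $ i)}"

lemma finite_mod_kernel: "finite (mod_kernel m A)"
proof (rule finite_subset)
  let ?S = "PiE {..<dim_col A} (\<lambda>_. {0..<m})"
  show "mod_kernel m A \<subseteq> vec (dim_col A) ` ?S"
  proof
    fix x assume x: "x \<in> mod_kernel m A"
    then have "x = vec (dim_col A) (restrict (vec_index x) {..<dim_col A})"
      by (auto simp: mod_kernel_def)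
    moreover have "restrict (vec_index x) {..<dim_col A} \<in> ?S"
      using x by (auto simp: mod_kernel_def)
    ultimately show "x \<in> vec (dim_col A) ` ?S" by blast
  qed
qed (auto intro!: finite_PiE)

lemma card_mod_kernel_diagonal:
  assumes D: "D \<in> carrier_mat n n" "diagonal_mat D" and m: "m > 0"
  shows "int (card (mod_kernel m D)) = (\<Prod>i<n. gcd (D $$ (i, i)) m)"
proof -
  let ?T = "\<lambda>i. {x \<in> {0..<m}. m dvd D $$ (i, i) * x}"
  have mult: "(D *\<^sub>v x) $ i = D $$ (i, i) * x $ i" if "x \<in> carrier_vec n" "i < n" for x i
  proof -
    have "(D *\<^sub>v x) $ i = (\<Sum>j\<in>{0..<n}. D $$ (i, j) * x $ j)"
      using that D by (simp add: scalar_prod_def)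
    also have "\<dots> = (\<Sum>j\<in>{0..<n}. if j = i then D $$ (i, i) * x $ i else 0)"
      using that D by (intro sum.cong) (auto simp: diagonal_mat_def)
    finally show ?thesis using that by simp
  qed
  have "mod_kernel m D = vec n ` PiE {..<n} ?T"
  proof (intro equalityI subsetI)
    fix x assume x: "x \<in> mod_kernel m D"
    then have c: "x \<in> carrier_vec n" using D by (auto simp: mod_kernel_def)
    then have "x = vec n (restrict (vec_index x) {..<n})" by auto
    moreover have "restrict (vec_index x) {..<n} \<in> PiE {..<n} ?T"
      using x c D by (auto simp: mod_kernel_def mult[OF c] simp del: index_mult_mat_vec)
    ultimately show "x \<in> vec n ` PiE {..<n} ?T" by blast
  next
    fix x assume "x \<in> vec n ` PiE {..<n} ?T"
    then obtain f where f: "f \<in> PiE {..<n} ?T" "x = vec n f" by blast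
    then have c: "x \<in> carrier_vec n" by simp
    have "f i \<in> ?T i" if "i < n" for i using f(1) that by (auto dest: PiE_mem)
    then show "x \<in> mod_kernel m D"
      using c D mult[OF c] f(2) by (auto simp: mod_kernel_def simp del: index_mult_mat_vec)
  qed
  moreover have "inj_on (vec n) (PiE {..<n} ?T)"
  proof (rule inj_onI)
    fix f g assume fg: "f \<in> PiE {..<n} ?T" "g \<in> PiE {..<n} ?T" "vec n f = vec n g"
    then have "f i = g i" if "i < n" for i by (metis index_vec that)
    with fg show "f = g" by (intro PiE_ext[of f _ _ g]) auto
  qed
  ultimately have "card (mod_kernel m D) = (\<Prod>i<n. card (?T i))"
    by (simp add: card_image card_PiE)
  then show ?thesis using card_annihilated_mod[OF m] by simp
qed

lemma dvd_mult_mat_vec: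
  fixes A :: "int mat"
  assumes "A \<in> carrier_mat n k" "v \<in> carrier_vec k" "\<And>i. i < k \<Longrightarrow> m dvd v $ i" "i < n"
  shows "m dvd (A *\<^sub>v v) $ i"
  using assms by (auto simp: scalar_prod_def intro!: dvd_sum dvd_mult)

text \<open>The map x -> Qx mod m sends the kernel of PAQ injectively into that of A:
  \<open>P'\<close> recovers A(Qx) from PAQx, and \<open>Q'\<close> recovers x modulo m from Qx.
  Applied in both directions it yields equality.\<close>

lemma card_mod_kernel_mult_le:
  assumes carrier: "A \<in> carrier_mat n n" "P \<in> carrier_mat n n" "Q \<in> carrier_mat n n"
      "P' \<in> carrier_mat n n" "Q' \<in> carrier_mat n n"
    and inv: "P' * P = 1\<^sub>m n" "Q' * Q = 1\<^sub>m n" and m: "m > 0"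
  shows "card (mod_kernel m (P * A * Q)) \<le> card (mod_kernel m A)"
proof (rule card_inj_on_le)
  let ?f = "\<lambda>x. map_vec (\<lambda>a. a mod m) (Q *\<^sub>v x)"
  have K: "x \<in> carrier_vec n" "\<And>i. i < n \<Longrightarrow> x $ i \<in> {0..<m}"
    "\<And>i. i < n \<Longrightarrow> m dvd (P * A * Q *\<^sub>v x) $ i" if "x \<in> mod_kernel m (P * A * Q)" for x
    using that carrier by (auto simp: mod_kernel_def)
  show "?f ` mod_kernel m (P * A * Q) \<subseteq> mod_kernel m A"
  proof
    fix z assume "z \<in> ?f ` mod_kernel m (P * A * Q)"
    then obtain x where x: "x \<in> mod_kernel m (P * A * Q)" and z: "z = ?f x" by blast
    note x = K[OF x]
    have Qx: "Q *\<^sub>v x \<in> carrier_vec n" and zc: "z \<in> carrier_vec n"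
      using carrier x(1) z by auto
    have "A *\<^sub>v (Q *\<^sub>v x) = P' *\<^sub>v (P * A * Q *\<^sub>v x)"
    proof -
      have "P' *\<^sub>v (P * A * Q *\<^sub>v x) = (P' * (P * (A * Q))) *\<^sub>v x"
        using carrier x(1) by (simp add: assoc_mult_mat_vec[of _ n n _ n])
      also have "P' * (P * (A * Q)) = (P' * P) * (A * Q)"
        using carrier by (simp add: assoc_mult_mat[of _ n n _ n _ n])
      finally show ?thesis
        using carrier x(1) inv by (simp add: assoc_mult_mat_vec[of _ n n _ n])
    qed
    moreover have "P * A * Q *\<^sub>v x \<in> carrier_vec n"
      by (intro mult_mat_vec_carrier mult_carrier_mat) (use carrier x(1) in auto)
    ultimately have 1: "m dvd (A *\<^sub>v (Q *\<^sub>v x)) $ i" if "i < n" for i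
      using dvd_mult_mat_vec[OF carrier(4) _ x(3) that] by simp
    \<comment> \<open>Reducing the entries of Qx to residues changes it by multiples of m
      only.\<close>
    have "m dvd (Q *\<^sub>v x - z) $ i" if "i < n" for i
      using that carrier Qx z by (simp add: minus_mod_eq_mult_div)
    then have 2: "m dvd (A *\<^sub>v (Q *\<^sub>v x - z)) $ i" if "i < n" for i
      using dvd_mult_mat_vec[OF carrier(1) _ _ that] Qx zc by simp
    have "m dvd (A *\<^sub>v z) $ i" if "i < n" for i
    proof -
      have "A *\<^sub>v (Q *\<^sub>v x - z) = A *\<^sub>v (Q *\<^sub>v x) - A *\<^sub>v z"
        by (rule mult_minus_distrib_mat_vec[OF carrier(1) Qx zc])
      then have "(A *\<^sub>v (Q *\<^sub>v x - z)) $ i = (A *\<^sub>v (Q *\<^sub>v x)) $ i - (A *\<^sub>v z) $ i"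
        using that carrier zc by (simp del: index_mult_mat_vec)
      with 1[OF that] 2[OF that] show ?thesis by (metis dvd_diff_right_iff)
    qed
    with z zc m carrier show "z \<in> mod_kernel m A" by (auto simp: mod_kernel_def)
  qed
  show "inj_on ?f (mod_kernel m (P * A * Q))"
  proof (rule inj_onI)
    fix x y assume "x \<in> mod_kernel m (P * A * Q)" "y \<in> mod_kernel m (P * A * Q)"
      and eq: "?f x = ?f y"
    note x = K[OF this(1)] and y = K[OF this(2)]
    have c: "x - y \<in> carrier_vec n" "Q *\<^sub>v x \<in> carrier_vec n" "Q *\<^sub>v y \<in> carrier_vec n"
      using x(1) y(1) carrier by auto
    have "m dvd (Q *\<^sub>v (x - y)) $ i" if "i < n" for i
    proof -
      have "?f x $ i = ?f y $ i" using eq by simp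
      then have "(Q *\<^sub>v x) $ i mod m = (Q *\<^sub>v y) $ i mod m"
        using c(2,3) that carrier(3) by (simp del: index_mult_mat_vec)
      then have "m dvd (Q *\<^sub>v x - Q *\<^sub>v y) $ i"
        using c(2,3) that carrier(3) by (simp add: mod_eq_dvd_iff del: index_mult_mat_vec)
      then show ?thesis using mult_minus_distrib_mat_vec[OF carrier(3) x(1) y(1)] by simp
    qed
    then have "m dvd (Q' *\<^sub>v (Q *\<^sub>v (x - y))) $ i" if "i < n" for i
      using dvd_mult_mat_vec[OF carrier(5) _ _ that] carrier c(1) by simp
    moreover have "Q' *\<^sub>v (Q *\<^sub>v (x - y)) = x - y"
      using carrier c(1) inv by (simp flip: assoc_mult_mat_vec[of _ n n _ n])
    ultimately have "m dvd x $ i - y $ i" if "i < n" for i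
      using that x(1) y(1) by simp
    then have "x $ i = y $ i" if "i < n" for i
      using x(2) y(2) that by (metis atLeastLessThan_iff mod_eq_dvd_iff mod_pos_pos_trivial)
    with x(1) y(1) show "x = y" by auto
  qed
qed (rule finite_mod_kernel)

text \<open>\<open>invertible_mat\<close> does not state the dimensions of the inverse; they are
  read off from the two products.\<close>

lemma invertible_mat_obtain:
  assumes "A \<in> carrier_mat n n" "invertible_mat A"
  obtains B where "B \<in> carrier_mat n n" "A * B = 1\<^sub>m n" "B * A = 1\<^sub>m n"
proof -
  obtain B where B: "A * B = 1\<^sub>m n" "B * A = 1\<^sub>m (dim_row B)"
    using assms by (auto simp: invertible_mat_def inverts_mat_def)
  have "dim_col B = n" using arg_cong[OF B(1), of dim_col] by simp
  moreover have "dim_row B = n" using arg_cong[OF B(2), of dim_col] assms by simp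
  ultimately show ?thesis using that[of B] B by auto
qed

lemma card_mod_kernel_smith_normal_form:
  assumes A: "A \<in> carrier_mat n n" and D: "smith_normal_form_of A D" and m: "m > 0"
  shows "card (mod_kernel m D) = card (mod_kernel m A)"
proof -
  obtain P Q where PQ: "P \<in> carrier_mat n n" "invertible_mat P" "Q \<in> carrier_mat n n"
      "invertible_mat Q" and D: "D = P * A * Q"
    using A D by (auto simp: smith_normal_form_of_def)
  obtain P' where P': "P' \<in> carrier_mat n n" "P * P' = 1\<^sub>m n" "P' * P = 1\<^sub>m n"
    using invertible_mat_obtain PQ(1,2) .
  obtain Q' where Q': "Q' \<in> carrier_mat n n" "Q * Q' = 1\<^sub>m n" "Q' * Q = 1\<^sub>m n"
    using invertible_mat_obtain PQ(3,4) .
  note c = A PQ(1,3) P'(1) Q'(1)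
  have "P' * D * Q' = (P' * P) * A * (Q * Q')"
    using c unfolding D by (simp add: assoc_mult_mat[of _ n n _ n _ n])
  then have A': "P' * D * Q' = A" using c P' Q' by simp
  have Dc: "D \<in> carrier_mat n n" using c by (simp add: D)
  show ?thesis
  proof (rule antisym)
    show "card (mod_kernel m D) \<le> card (mod_kernel m A)"
      unfolding D using c P'(3) Q'(3) m by (rule card_mod_kernel_mult_le)
    show "card (mod_kernel m A) \<le> card (mod_kernel m D)"
      using card_mod_kernel_mult_le[OF Dc P'(1) Q'(1) PQ(1,3) P'(2) Q'(2) m] A' by simp
  qed
qed

text \<open>Large multiples \<open>m\<close> show how many entries vanish and what the product of
  the others is; a special \<open>m\<close> then shows that all entries before position
  \<open>k\<close> are units.\<close>

lemma divisor_chain_unique: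
  fixes d :: "nat \<Rightarrow> int"
  assumes count: "\<And>m. m > 0 \<Longrightarrow> (\<Prod>i<Suc (Suc k). gcd (d i) m) = m * gcd f m"
    and dvd: "\<And>i. i < Suc k \<Longrightarrow> d i dvd d (Suc i)"
    and f: "f > 0"
  shows "d (Suc k) = 0" "\<bar>d k\<bar> = f" "\<And>i. i < k \<Longrightarrow> \<bar>d i\<bar> = 1"
proof -
  have chain: "d i dvd d j" if "i \<le> j" "j \<le> Suc k" for i j
    using that by (induction j rule: dec_induct) (auto intro: dvd_trans[OF _ dvd])
  let ?N = "{..<Suc (Suc k)}"
  define Z where "Z = {i \<in> ?N. d i = 0}"
  define c where "c = (\<Prod>i\<in>?N - Z. \<bar>d i\<bar>)"
  have c: "c > 0" unfolding c_def by (intro prod_pos) (auto simp: Z_def)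
  \<comment> \<open>For such \<open>m\<close> every nonzero \<open>d i\<close> divides
    \<open>m\<close> and contributes its absolute value, while every zero entry contributes
    \<open>m\<close>.\<close>
  have prod: "c * m ^ card Z = m * f" if m: "m > 0" "c * f dvd m" for m
  proof -
    have "f dvd m" using m(2) by (rule dvd_mult_right)
    then have "gcd f m = f" using f by (simp add: gcd_proj1_if_dvd_int)
    moreover have "gcd (d i) m = \<bar>d i\<bar>" if "i \<in> ?N - Z" for i
    proof -
      have "\<bar>d i\<bar> dvd c" unfolding c_def using that by (intro dvd_prodI) auto
      then have "d i dvd m" using m by (meson abs_dvd_iff dvd_mult_left dvd_trans)
      then show ?thesis by (simp add: gcd_proj1_if_dvd_int)
    qed
    moreover have "gcd (d i) m = m" if "i \<in> Z" for i using that m by (simp add: Z_def)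
    moreover have "(\<Prod>i\<in>?N. gcd (d i) m) = (\<Prod>i\<in>?N - Z. gcd (d i) m) * (\<Prod>i\<in>Z. gcd (d i) m)"
      by (rule prod.subset_diff) (auto simp: Z_def)
    ultimately show ?thesis using count[OF m(1)] by (simp add: c_def)
  qed
  \<comment> \<open>Compare \<open>m = c * f\<close> with its double: one side gains the factor
    \<open>2 ^ card Z\<close>, the other the factor 2. So exactly one entry vanishes, and by
    divisibility it is the last one.\<close>
  have "2 ^ card Z * (c * f * f) = 2 ^ card Z * (c * (c * f) ^ card Z)"
    using prod[of "c * f"] c f by simp
  also have "\<dots> = c * (2 * (c * f)) ^ card Z" by (simp add: power_mult_distrib)
  also have "\<dots> = 2 * (c * f * f)"
    using prod[of "2 * (c * f)"] c f by simp
  finally have "2 ^ card Z * (c * f * f) = 2 * (c * f * f)" .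
  then have "2 ^ card Z = (2 ^ 1 :: int)" using c f by simp
  then have cardZ: "card Z = 1" using power_inject_exp[of "2::int"] by fastforce
  then obtain z where z: "Z = {z}" by (auto simp: card_1_singleton_iff)
  then have "z \<in> Z" by simp
  then have "z \<le> Suc k" "d z = 0" by (auto simp: Z_def)
  then have "d (Suc k) = 0" using chain[of z "Suc k"] by simp
  then have "Suc k \<in> Z" by (simp add: Z_def)
  with z have Z: "Z = {Suc k}" by auto
  show "d (Suc k) = 0" by fact
  have nz: "d i \<noteq> 0" if "i \<le> k" for i
  proof
    assume "d i = 0"
    then have "i \<in> Z" using that by (simp add: Z_def)
    with Z that show False by simp
  qed
  have "?N - Z = {..<Suc k}" unfolding Z by auto
  moreover have "c = f"
    using prod[of "c * f"] c f cardZ by simp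
  ultimately have cf: "(\<Prod>i<Suc k. \<bar>d i\<bar>) = f" by (simp only: c_def)
  show unit: "\<bar>d i\<bar> = 1" if ik: "i < k" for i
  proof -
    obtain j where j: "k = Suc j" using ik by (cases k) auto
    \<comment> \<open>For j = k-1 this \<open>m\<close> divides the last three entries, so m^3 is at
      most m gcd(f, m), hence at most m^2. This forces m = 1, and the earlier entries divide
      \<open>d j\<close>.\<close>
    define m where "m = \<bar>d j\<bar>"
    have m: "m > 0" using nz[of j] j by (simp add: m_def)
    have "gcd (d l) m = m" if "l \<in> {j, Suc j, Suc (Suc j)}" for l
    proof -
      have "d j dvd d l" using that by (intro chain) (auto simp: j)
      then show ?thesis by (simp add: m_def gcd_proj2_if_dvd_int)
    qed
    then have eq: "(\<Prod>l<j. gcd (d l) m) * m * m * m = m * gcd f m"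
      using count[OF m] by (simp add: j)
    have "(\<Prod>l<j. gcd (d l) m) \<ge> 1"
      using m by (intro prod_ge_1) (simp add: int_one_le_iff_zero_less)
    then have "1 * (m * m) \<le> (\<Prod>l<j. gcd (d l) m) * (m * m)"
      by (intro mult_right_mono) auto
    also have "\<dots> = gcd f m" using eq m by (simp add: mult_ac)
    also have "\<dots> \<le> m" using m by (simp add: gcd_le2_int)
    finally have "m * m \<le> m * 1" by simp
    then have "m = 1" using m by (simp only: mult_le_cancel_left_pos)
    moreover have "d i dvd m" using chain[of i j] ik j by (simp add: m_def)
    ultimately show ?thesis by simp
  qed
  have "(\<Prod>i<k. \<bar>d i\<bar>) = 1" using unit by (intro prod.neutral) simp
  then show "\<bar>d k\<bar> = f" using cf by simp
qed

text \<open>The isomorphism is the projection to the coordinate \<open>i0\<close>.\<close>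

lemma sum_group_iso_only_nontrivial:
  assumes group: "\<And>i. i \<in> I \<Longrightarrow> group (H i)" and i0: "i0 \<in> I"
    and triv: "\<And>i. i \<in> I \<Longrightarrow> i \<noteq> i0 \<Longrightarrow> carrier (H i) = {\<one>\<^bsub>H i\<^esub>}"
  shows "sum_group I H \<cong> H i0"
proof (rule is_isoI)
  show "(\<lambda>x. x i0) \<in> iso (sum_group I H) (H i0)"
  proof (rule isoI)
    show "(\<lambda>x. x i0) \<in> hom (sum_group I H) (H i0)"
      using i0 by (auto simp: hom_def carrier_sum_group group)
    show "bij_betw (\<lambda>x. x i0) (carrier (sum_group I H)) (carrier (H i0))"
    proof (rule bij_betwI')
      fix x y assume xy: "x \<in> carrier (sum_group I H)" "y \<in> carrier (sum_group I H)"
      show "x i0 = y i0 \<longleftrightarrow> x = y"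
      proof
        assume eq: "x i0 = y i0"
        have xy': "x \<in> PiE I (\<lambda>i. carrier (H i))" "y \<in> PiE I (\<lambda>i. carrier (H i))"
          using xy by (auto simp: carrier_sum_group group)
        then have "x i = y i" if "i \<in> I" for i
          using eq triv[OF that] PiE_mem[OF xy'(1) that] PiE_mem[OF xy'(2) that]
          by (cases "i = i0") auto
        with xy' show "x = y" by (intro PiE_ext) auto
      qed simp
    next
      fix g assume g: "g \<in> carrier (H i0)"
      let ?x = "\<lambda>i\<in>I. if i = i0 then g else \<one>\<^bsub>H i\<^esub>"
      have "finite {i \<in> I. ?x i \<noteq> \<one>\<^bsub>H i\<^esub>}"
        by (rule finite_subset[of _ "{i0}"]) auto
      moreover have "?x \<in> PiE I (\<lambda>i. carrier (H i))"
        using g group by (auto intro!: monoid.one_closed group.is_monoid)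
      ultimately have "?x \<in> carrier (sum_group I H)" by (simp add: carrier_sum_group group)
      then show "\<exists>x\<in>carrier (sum_group I H). g = x i0"
        using i0 by (intro bexI[of _ ?x]) auto
    qed (use i0 in \<open>auto simp: carrier_sum_group group\<close>)
  qed
qed


section \<open>The Laplacian of a chain of cycles\<close>

lemma invertible_mat_if_det_unit:
  fixes A :: "int mat"
  assumes A: "A \<in> carrier_mat n n" and unit: "det A dvd 1"
  shows "invertible_mat A"
proof -
  obtain u where u: "det A * u = 1" using unit by (metis dvdE)
  \<comment> \<open>The adjugate inverts \<open>A\<close> up to the factor \<open>det A\<close>,
    which \<open>u\<close> cancels.\<close>
  let ?B = "u \<cdot>\<^sub>m adj_mat A"
  have B: "?B \<in> carrier_mat n n" using adj_mat(1)[OF A] by simp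
  have "u \<cdot>\<^sub>m (det A \<cdot>\<^sub>m 1\<^sub>m n) = 1\<^sub>m n"
    using u by (intro eq_matI) (auto simp: mult.commute)
  then have "A * ?B = 1\<^sub>m n" "?B * A = 1\<^sub>m n"
    using A adj_mat[OF A]
    by (simp_all add: mult_smult_distrib[of _ n n _ n] mult_smult_assoc_mat[of _ n n _ n])
  then show ?thesis
    using A B unfolding invertible_mat_def inverts_mat_def by (intro conjI exI[of _ ?B]) auto
qed

lemma invertible_mat_if_triangular_permuted:
  fixes A :: "int mat"
  assumes A: "A \<in> carrier_mat n n" and p: "p permutes {0..<n}"
    and tri: "(\<forall>i j. i < j \<longrightarrow> j < n \<longrightarrow> A $$ (p i, j) = 0) \<or>
      (\<forall>i j. j < i \<longrightarrow> i < n \<longrightarrow> A $$ (p i, j) = 0)"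
    and diag: "\<And>i. i < n \<Longrightarrow> A $$ (p i, i) dvd 1"
  shows "invertible_mat A"
proof -
  let ?B = "mat n n (\<lambda>(i, j). A $$ (p i, j))"
  have "det ?B = prod_list (diag_mat ?B)"
    using tri
    by (elim disjE; intro det_lower_triangular[of n] det_upper_triangular[of _ n]) auto
  also have "\<dots> = (\<Prod>i = 0..<n. A $$ (p i, i))"
    by (simp add: prod_list_diag_prod)
  also have "\<dots> dvd (\<Prod>i = 0..<n. 1)" using diag by (intro prod_dvd_prod) auto
  finally have "det ?B dvd 1" by simp
  then have "det A dvd 1"
    \<comment> \<open>\<open>det ?B\<close> is the sign of \<open>p\<close> times
      \<open>det A\<close>, so \<open>det A\<close> is a factor of a unit.\<close>
    unfolding det_permute_rows[OF A p] by (rule dvd_mult_right)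
  with A show ?thesis by (rule invertible_mat_if_det_unit)
qed

lemma count_image_mset_mset_set:
  "finite A \<Longrightarrow> count (image_mset f (mset_set A)) x = card {a \<in> A. f a = x}"
  by (simp add: count_image_mset vimage_def Int_def conj_commute)

lemma size_filter_image_mset_mset_set:
  "finite A \<Longrightarrow> size {#e \<in># image_mset f (mset_set A). P e#} = card {a \<in> A. P (f a)}"
  by (simp add: filter_mset_image_mset)

section \<open>Spokes, degrees and the entries of the Laplacian\<close>

locale cycle_chain =
  fixes n :: nat and a :: "nat \<Rightarrow> int"
  assumes length_ge_2: "\<And>m. 1 \<le> m \<Longrightarrow> m \<le> n \<Longrightarrow> 2 \<le> a m"
begin

text \<open>The path is \<open>u\<^sub>1, \<dots>, u\<^bsub>r+1\<^esub>\<close>; using \<open>r = k - 1\<close> avoids truncated subtraction.\<close>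

definition r :: nat where "r = nat (chain_pos a n - 1)"

definition spoke :: "nat \<Rightarrow> nat" where "spoke j = nat (chain_pos a j)"

text \<open>The multiplicity of the edge between the center and u_i; cycles of length 2 make several
  spokes end at one vertex.\<close>

definition spokes_at :: "nat \<Rightarrow> nat" where "spokes_at i = card {j \<in> {0..n}. spoke j = i}"

abbreviation "L \<equiv> laplacian (chain n a)"

lemma chain_pos_ge_1: "j \<le> n \<Longrightarrow> 1 \<le> chain_pos a j"
  using chain_pos_mono[of n a 0 j] length_ge_2 by (simp add: chain_pos_def[of a 0])

lemma chain_pos_n: "chain_pos a n = int (Suc r)"
  using chain_pos_ge_1[of n] by (simp add: r_def)

lemma chain_pos_eq_spoke: "j \<le> n \<Longrightarrow> chain_pos a j = int (spoke j)"
  using chain_pos_ge_1[of j] by (simp add: spoke_def)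

lemma spoke_0: "spoke 0 = 1"
  by (simp add: spoke_def chain_pos_def)

lemma spoke_mono: "i \<le> j \<Longrightarrow> j \<le> n \<Longrightarrow> spoke i \<le> spoke j"
  using chain_pos_mono[of n a i j] length_ge_2 unfolding spoke_def by (intro nat_mono) auto

lemma spoke_ge_1: "j \<le> n \<Longrightarrow> 1 \<le> spoke j"
  using spoke_mono[of 0 j] by (simp add: spoke_0)

lemma spoke_n: "spoke n = Suc r"
  by (simp add: spoke_def chain_pos_n)

lemma spoke_le: "j \<le> n \<Longrightarrow> spoke j \<le> Suc r"
  using spoke_mono[of j n] by (simp add: spoke_n)

lemma spoke_Suc: "Suc j \<le> n \<Longrightarrow> int (spoke (Suc j)) = int (spoke j) + (a (Suc j) - 2)"
  by (simp add: chain_pos_def flip: chain_pos_eq_spoke)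

text \<open>Matrix indices thus agree with vertices: index 0 is the center and index i is
  u_i.\<close>

lemma sorted_verts:
  "sorted_list_of_set (verts (chain n a)) = map int [0..<Suc (Suc r)]"
proof -
  have "set (map int [0..<Suc (Suc r)]) = {0..int (Suc r)}"
    by (simp add: image_int_atLeastAtMost atLeastLessThanSuc_atLeastAtMost del: upt_Suc)
  also have "\<dots> = verts (chain n a)"
    by (auto simp: chain_def chain_pos_n)
  finally show ?thesis
    using sorted_list_of_set.idem_if_sorted_distinct[of "map int [0..<Suc (Suc r)]"]
    by (simp add: sorted_map distinct_map strict_sorted_iff del: upt_Suc)
qed

lemma count_edges_path:
  assumes "1 \<le> i" "1 \<le> j" "i \<le> Suc r" "j \<le> Suc r" "i \<noteq> j"
  shows "count (edges (chain n a)) {int i, int j} = (if i = Suc j \<or> j = Suc i then 1 else 0)"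
proof -
  have "{t \<in> {1..<chain_pos a n}. {t, t + 1} = {int i, int j}} =
      (if i = Suc j \<or> j = Suc i then {int (min i j)} else {})"
    using assms by (auto simp: chain_pos_n doubleton_eq_iff)
  moreover have "{l \<in> {0..n}. {0, chain_pos a l} = {int i, int j}} = {}"
    using assms by (auto simp: doubleton_eq_iff)
  ultimately show ?thesis
    by (simp add: chain_def count_image_mset_mset_set del: Collect_empty_eq)
qed

lemma count_edges_center:
  assumes "1 \<le> i"
  shows "count (edges (chain n a)) {0, int i} = spokes_at i"
proof -
  have "{t \<in> {1..<chain_pos a n}. {t, t + 1} = {0, int i}} = {}"
    using assms by (auto simp: doubleton_eq_iff)
  moreover have "{l \<in> {0..n}. {0, chain_pos a l} = {0, int i}} = {j \<in> {0..n}. spoke j = i}"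
    using assms by (auto simp: doubleton_eq_iff chain_pos_eq_spoke)
  ultimately show ?thesis
    by (simp add: chain_def count_image_mset_mset_set spokes_at_def del: Collect_empty_eq)
qed

lemma degree_center: "Defs.degree (chain n a) 0 = Suc n"
proof -
  have "{t \<in> {1..<chain_pos a n}. 0 \<in> {t, t + 1}} = {}" by auto
  moreover have "{l \<in> {0..n}. 0 \<in> {0, chain_pos a l}} = {0..n}" by auto
  ultimately show ?thesis
    by (simp add: Defs.degree_def chain_def size_filter_image_mset_mset_set
      del: Collect_empty_eq insert_iff atLeastAtMost_iff atLeastLessThan_iff)
qed

lemma degree_path:
  assumes "1 \<le> i" "i \<le> Suc r"
  shows "Defs.degree (chain n a) (int i) =
    spokes_at i + (if 1 < i then 1 else 0) + (if i < Suc r then 1 else 0)"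
proof -
  have "{t \<in> {1..<chain_pos a n}. int i \<in> {t, t + 1}} =
      (if 1 < i then {int i - 1} else {}) \<union> (if i < Suc r then {int i} else {})"
    using assms by (auto simp: chain_pos_n)
  then have "card {t \<in> {1..<chain_pos a n}. int i \<in> {t, t + 1}} =
      (if 1 < i then 1 else 0) + (if i < Suc r then 1 else 0)"
    by simp
  moreover have "{l \<in> {0..n}. int i \<in> {0, chain_pos a l}} = {j \<in> {0..n}. spoke j = i}"
    using assms by (auto simp: chain_pos_eq_spoke)
  ultimately show ?thesis
    by (simp add: Defs.degree_def chain_def size_filter_image_mset_mset_set spokes_at_def
      del: Collect_empty_eq insert_iff)
qed

lemma laplacian_carrier: "L \<in> carrier_mat (Suc (Suc r)) (Suc (Suc r))"
  by (simp add: laplacian_def sorted_verts Let_def del: upt_Suc)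

lemma laplacian_index:
  assumes "i \<le> Suc r" "j \<le> Suc r"
  shows "L $$ (i, j) =
    (if i = j then int (Defs.degree (chain n a) (int i))
     else - int (count (edges (chain n a)) {int i, int j}))"
  using assms by (simp add: laplacian_def sorted_verts Let_def nth_append del: upt_Suc)

lemma laplacian_path_index:
  assumes "1 \<le> i" "i \<le> Suc r" "1 \<le> j" "j \<le> Suc r"
  shows "L $$ (i, j) =
    (if i = j then int (spokes_at i) + (if 1 < i then 1 else 0) + (if i < Suc r then 1 else 0)
     else if i = Suc j \<or> j = Suc i then -1 else 0)"
  using assms by (simp add: laplacian_index degree_path count_edges_path)

lemma laplacian_center_index:
  assumes "1 \<le> j" "j \<le> Suc r"
  shows "L $$ (0, j) = - int (spokes_at j)" "L $$ (j, 0) = - int (spokes_at j)"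
  using assms count_edges_center[of j] by (simp_all add: laplacian_index insert_commute)

lemma laplacian_row_path:
  assumes "1 \<le> i" "i \<le> Suc r"
  shows "(\<Sum>t<Suc (Suc r). L $$ (i, t) * f t) = int (spokes_at i) * (f i - f 0) +
    (if 1 < i then f i - f (i - 1) else 0) + (if i < Suc r then f i - f (Suc i) else 0)"
proof -
  \<comment> \<open>At most four columns contribute. For \<open>i = 1\<close> the column
    \<open>i - 1\<close> is that of the center, already counted by the first term, hence the guard
    \<open>1 < i\<close>.\<close>
  have "(\<Sum>t<Suc (Suc r). L $$ (i, t) * f t) = (\<Sum>t<Suc (Suc r).
      (if t = 0 then - int (spokes_at i) * f 0 else 0) +
      (if t = i then L $$ (i, i) * f i else 0) +
      (if t = i - 1 then (if 1 < i then - f (i - 1) else 0) else 0) +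
      (if t = Suc i then (if i < Suc r then - f (Suc i) else 0) else 0))"
  proof (rule sum.cong[OF refl])
    fix t assume "t \<in> {..<Suc (Suc r)}"
    then show "L $$ (i, t) * f t =
      (if t = 0 then - int (spokes_at i) * f 0 else 0) +
      (if t = i then L $$ (i, i) * f i else 0) +
      (if t = i - 1 then (if 1 < i then - f (i - 1) else 0) else 0) +
      (if t = Suc i then (if i < Suc r then - f (Suc i) else 0) else 0)"
      using assms by (cases "t = 0") (auto simp: laplacian_center_index laplacian_path_index)
  qed
  also have "\<dots> = - int (spokes_at i) * f 0 + L $$ (i, i) * f i +
      (if 1 < i then - f (i - 1) else 0) + (if i < Suc r then - f (Suc i) else 0)"
    using assms by (simp only: sum.distrib sum.delta finite_lessThan) auto
  finally show ?thesis
    using assms by (simp add: laplacian_path_index algebra_simps)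
qed

text \<open>Groups the spokes by their end vertex.\<close>

lemma sum_spokes: "(\<Sum>t = 1..Suc r. int (spokes_at t) * f t) = (\<Sum>j = 0..n. f (spoke j))"
proof -
  have "(\<Sum>t = 1..Suc r. int (spokes_at t) * f t) =
      (\<Sum>t = 1..Suc r. \<Sum>j | j \<in> {0..n} \<and> spoke j = t. f (spoke j))"
    by (intro sum.cong refl) (simp add: spokes_at_def)
  also have "\<dots> = (\<Sum>j = 0..n. f (spoke j))"
    using spoke_ge_1 spoke_le by (intro sum.group) auto
  finally show ?thesis .
qed

lemma laplacian_row_center:
  "(\<Sum>t<Suc (Suc r). L $$ (0, t) * f t) = (\<Sum>j = 0..n. f 0 - f (spoke j))"
proof -
  have "(\<Sum>t<Suc (Suc r). L $$ (0, t) * f t) =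
      L $$ (0, 0) * f 0 + (\<Sum>t = 1..Suc r. L $$ (0, t) * f t)"
    by (subst sum.lessThan_Suc_shift)
      (simp add: sum.atLeast_Suc_atMost_Suc_shift lessThan_Suc_atMost atMost_atLeast0
        del: sum.lessThan_Suc sum.cl_ivl_Suc)
  also have "(\<Sum>t = 1..Suc r. L $$ (0, t) * f t) = - (\<Sum>t = 1..Suc r. int (spokes_at t) * f t)"
    unfolding sum_negf[symmetric] by (intro sum.cong refl) (simp add: laplacian_center_index)
  also have "L $$ (0, 0) = int (Suc n)"
    using degree_center by (simp add: laplacian_index)
  finally show ?thesis
    by (simp only: sum_spokes) (simp add: sum_subtractf)
qed

text \<open>Harmonicity at \<open>u\<^sub>1, \<dots>, u\<^bsub>k-1\<^esub>\<close> means that the slope grows at the end of spoke \<open>l\<close> by the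
  value that the potential takes there. In \<open>potential\<close>, the truncated subtraction is intended:
  spokes beyond \<open>i\<close> do not contribute.\<close>

definition spoke_value :: "nat \<Rightarrow> int" where
  "spoke_value l = F l a - (if l = 0 then 0 else F (l - 1) a)"

definition slope :: "nat \<Rightarrow> int" where
  "slope i = (\<Sum>l = 0..n. if spoke l \<le> i then spoke_value l else 0)"

definition potential :: "nat \<Rightarrow> int" where
  "potential i =
    (if i = 0 then 0 else 1 + (\<Sum>l = 0..n. int (i - spoke l) * spoke_value l))"

lemma sum_spoke_value: "(\<Sum>l = 0..j. spoke_value l) = F j a"
  by (induction j) (simp_all add: spoke_value_def del: F.simps(3))

lemma spoke_value_Suc: "spoke_value (Suc j) = spoke_value j + (a (Suc j) - 2) * F j a"
  by (cases j) (simp_all add: spoke_value_def F_rec algebra_simps del: F.simps(3))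

text \<open>The right-hand side is the potential at the end of spoke \<open>j\<close>. Moving on to
  the next spoke lengthens every distance by \<open>a (Suc j) - 2\<close>, which adds that multiple
  of the telescoping sum \<open>F j a\<close>, as in \<open>spoke_value_Suc\<close>.\<close>

lemma spoke_value_eq:
  assumes "j \<le> n"
  shows "spoke_value j = 1 + (\<Sum>l = 0..j. (int (spoke j) - int (spoke l)) * spoke_value l)"
  using assms
proof (induction j)
  case 0
  then show ?case by (simp add: spoke_value_def)
next
  case (Suc j)
  have "(\<Sum>l = 0..Suc j. (int (spoke (Suc j)) - int (spoke l)) * spoke_value l) =
      (\<Sum>l = 0..j. (int (spoke j) - int (spoke l)) * spoke_value l + (a (Suc j) - 2) * spoke_value l)"
    using Suc.prems by (auto simp: spoke_Suc algebra_simps intro!: sum.cong)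
  also have "\<dots> = (\<Sum>l = 0..j. (int (spoke j) - int (spoke l)) * spoke_value l) +
      (a (Suc j) - 2) * F j a"
    by (simp only: sum.distrib sum_distrib_left[symmetric] sum_spoke_value)
  finally show ?case using Suc by (simp add: spoke_value_Suc)
qed

lemma potential_spoke:
  assumes "j \<le> n"
  shows "potential (spoke j) = spoke_value j"
proof -
  \<comment> \<open>Spokes after \<open>j\<close> end no earlier than \<open>spoke j\<close>, so
    their truncated differences vanish.\<close>
  have "(\<Sum>l = 0..n. int (spoke j - spoke l) * spoke_value l) =
      (\<Sum>l = 0..j. int (spoke j - spoke l) * spoke_value l)"
    using assms spoke_mono[of j] by (intro sum.mono_neutral_right) auto
  also have "\<dots> = (\<Sum>l = 0..j. (int (spoke j) - int (spoke l)) * spoke_value l)"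
    using assms spoke_mono[of _ j] by (intro sum.cong refl) (simp add: of_nat_diff)
  finally show ?thesis
    using spoke_value_eq[OF assms] spoke_ge_1[OF assms] by (simp add: potential_def)
qed

text \<open>The truncated difference for spoke \<open>l\<close> grows by 1 exactly when
  \<open>spoke l\<close> is at most \<open>i\<close>.\<close>

lemma potential_Suc: "1 \<le> i \<Longrightarrow> potential (Suc i) = potential i + slope i"
  unfolding potential_def slope_def
  by (auto simp: sum.distrib[symmetric] Suc_diff_le algebra_simps intro!: sum.cong)

lemma slope_0: "slope 0 = 0"
  unfolding slope_def using spoke_ge_1 by (intro sum.neutral) fastforce

lemma slope_last: "slope (Suc r) = F n a"
  unfolding slope_def sum_spoke_value[symmetric] using spoke_le by (intro sum.cong) auto

text \<open>All spokes ending at u_i carry the same value \<open>potential i\<close>, so their joint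
  contribution is this value times their number.\<close>

lemma slope_step:
  assumes "1 \<le> i"
  shows "slope i = slope (i - 1) + int (spokes_at i) * potential i"
proof -
  have "int (spokes_at i) * potential i = (\<Sum>l\<in>{j \<in> {0..n}. spoke j = i}. potential i)"
    by (simp add: spokes_at_def)
  also have "\<dots> = (\<Sum>l\<in>{j \<in> {0..n}. spoke j = i}. spoke_value l)"
    by (intro sum.cong refl) (auto simp: potential_spoke[symmetric])
  also have "\<dots> = (\<Sum>l = 0..n. if spoke l = i then spoke_value l else 0)"
    by (rule sum.inter_filter) simp
  finally show ?thesis
    using assms by (auto simp: slope_def sum.distrib[symmetric] intro!: sum.cong)
qed

lemma potential_1: "potential 1 = 1"
  using potential_spoke[of 0] by (simp add: spoke_0 spoke_value_def)

text \<open>At u_i the spokes and the left edge contribute \<open>slope i\<close>, cancelled by the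
  right edge except at the last vertex, where \<open>F n a\<close> remains. At the center the spoke
  values telescope to \<open>- F n a\<close>.\<close>

lemma laplacian_potential:
  assumes "i < Suc (Suc r)"
  shows "(\<Sum>t<Suc (Suc r). L $$ (i, t) * potential t) =
    F n a * (if i = Suc r then 1 else if i = 0 then -1 else 0)"
proof (cases "i = 0")
  case True
  have "(\<Sum>j = 0..n. potential 0 - potential (spoke j)) = - F n a"
    unfolding sum_spoke_value[symmetric] sum_negf[symmetric]
    by (intro sum.cong refl) (simp add: potential_spoke, simp add: potential_def)
  with True show ?thesis by (simp only: laplacian_row_center) simp
next
  case False
  \<comment> \<open>u_1 has no left path edge; \<open>slope 0 = 0\<close> makes the formula
    uniform.\<close>
  have prev: "(if 1 < i then potential i - potential (i - 1) else 0) = slope (i - 1)"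
    using False potential_Suc[of "i - 1"] slope_0 by (cases "i = 1") auto
  have "(\<Sum>t<Suc (Suc r). L $$ (i, t) * potential t) =
      slope i + (if i < Suc r then - slope i else 0)"
    using False assms laplacian_row_path[of i potential] prev slope_step[of i] potential_Suc[of i]
    by (simp add: potential_def[of 0] del: sum.lessThan_Suc)
  with assms False slope_last show ?thesis by (auto simp del: sum.lessThan_Suc)
qed

lemma laplacian_const:
  assumes "i < Suc (Suc r)"
  shows "(\<Sum>t<Suc (Suc r). L $$ (i, t)) = 0"
  using assms laplacian_row_center[of "\<lambda>_. 1"] laplacian_row_path[of i "\<lambda>_. 1"]
  by (cases "i = 0") (auto simp del: sum.lessThan_Suc)

section \<open>The Smith normal form of the Laplacian\<close>

definition elementary_divisor :: "nat \<Rightarrow> int" where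
  "elementary_divisor i = (if i < r then 1 else if i = r then F n a else 0)"

definition smith_mat :: "int mat" where
  "smith_mat = mat (Suc (Suc r)) (Suc (Suc r)) (\<lambda>(i, j). if i = j then elementary_divisor i else 0)"

text \<open>The columns are the unit vectors at u_2, ..., u_k, then the potential, then the constant
  vector 1.\<close>

definition source_basis :: "int mat" where
  "source_basis = mat (Suc (Suc r)) (Suc (Suc r)) (\<lambda>(i, j).
     if j < r then (if i = Suc (Suc j) then 1 else 0) else if j = r then potential i else 1)"

text \<open>The columns are the images of u_2, ..., u_k, then u_k - c, then c. The last one belongs
  to the divisor 0 and is chosen to complete a basis.\<close>

definition target_basis :: "int mat" where
  "target_basis = mat (Suc (Suc r)) (Suc (Suc r)) (\<lambda>(i, j).
     if j < r then L $$ (i, Suc (Suc j))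
     else if j = r then (if i = Suc r then 1 else if i = 0 then -1 else 0)
     else if i = 0 then 1 else 0)"

text \<open>Column \<open>j\<close> on the right is \<open>elementary_divisor j\<close> times column
  \<open>j\<close> of \<open>target_basis\<close>, so the three kinds of columns are compared
  separately.\<close>

lemma laplacian_mult_source_basis: "L * source_basis = target_basis * smith_mat"
proof (rule eq_matI)
  fix i j assume "i < dim_row (target_basis * smith_mat)" "j < dim_col (target_basis * smith_mat)"
  then have ij: "i < Suc (Suc r)" "j < Suc (Suc r)"
    by (auto simp: target_basis_def smith_mat_def)
  have "(target_basis * smith_mat) $$ (i, j) =
      (\<Sum>t<Suc (Suc r). target_basis $$ (i, t) * smith_mat $$ (t, j))"
    using ij by (simp add: target_basis_def smith_mat_def scalar_prod_def atLeast0LessThan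
      del: sum.lessThan_Suc)
  also have "\<dots> = (\<Sum>t<Suc (Suc r).
      if t = j then target_basis $$ (i, j) * elementary_divisor j else 0)"
    using ij by (intro sum.cong refl) (auto simp: smith_mat_def)
  also have "\<dots> = target_basis $$ (i, j) * elementary_divisor j"
    using ij by (simp add: sum.delta del: sum.lessThan_Suc)
  finally have rhs: "(target_basis * smith_mat) $$ (i, j) =
    target_basis $$ (i, j) * elementary_divisor j" .
  have lhs: "(L * source_basis) $$ (i, j) =
      (\<Sum>t<Suc (Suc r). L $$ (i, t) * source_basis $$ (t, j))"
    using ij laplacian_carrier
    by (simp add: source_basis_def scalar_prod_def atLeast0LessThan del: sum.lessThan_Suc)
  consider "j < r" | "j = r" | "j = Suc r" using ij by linarith
  then show "(L * source_basis) $$ (i, j) = (target_basis * smith_mat) $$ (i, j)"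
  proof cases
    case 1
    then have "(\<Sum>t<Suc (Suc r). L $$ (i, t) * source_basis $$ (t, j)) =
        (\<Sum>t<Suc (Suc r). if t = Suc (Suc j) then L $$ (i, Suc (Suc j)) else 0)"
      using ij by (intro sum.cong refl) (auto simp: source_basis_def)
    also have "\<dots> = L $$ (i, Suc (Suc j))"
      using 1 by (simp add: sum.delta del: sum.lessThan_Suc)
    finally show ?thesis
      unfolding lhs rhs using 1 ij by (simp add: target_basis_def elementary_divisor_def)
  next
    case 2
    then have "(\<Sum>t<Suc (Suc r). L $$ (i, t) * source_basis $$ (t, j)) =
        (\<Sum>t<Suc (Suc r). L $$ (i, t) * potential t)"
      by (intro sum.cong refl) (auto simp: source_basis_def)
    with 2 ij show ?thesis
      unfolding lhs rhs by (simp add: laplacian_potential target_basis_def elementary_divisor_def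
        del: sum.lessThan_Suc)
  next
    case 3
    then have "(\<Sum>t<Suc (Suc r). L $$ (i, t) * source_basis $$ (t, j)) =
        (\<Sum>t<Suc (Suc r). L $$ (i, t))"
      by (intro sum.cong refl) (auto simp: source_basis_def)
    with 3 ij show ?thesis
      unfolding lhs rhs by (simp add: laplacian_const elementary_divisor_def del: sum.lessThan_Suc)
  qed
qed (use laplacian_carrier in \<open>auto simp: source_basis_def target_basis_def smith_mat_def\<close>)

lemma invertible_source_basis: "invertible_mat source_basis"
proof (rule invertible_mat_if_triangular_permuted)
  \<comment> \<open>The row order u_2, ..., u_k, u_1, c gives an upper triangular matrix with ones
    on the diagonal, because the potential is 1 at u_1 and 0 at c.\<close>
  let ?p = "\<lambda>i. if i < r then Suc (Suc i) else if i = r then 1 else if i = Suc r then 0 else i"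
  show "?p permutes {0..<Suc (Suc r)}"
    by (rule inj_imp_permutes) (auto simp: inj_on_def split: if_splits)
  show "(\<forall>i j. i < j \<longrightarrow> j < Suc (Suc r) \<longrightarrow> source_basis $$ (?p i, j) = 0) \<or>
      (\<forall>i j. j < i \<longrightarrow> i < Suc (Suc r) \<longrightarrow> source_basis $$ (?p i, j) = 0)"
    by (rule disjI2) (auto simp: source_basis_def potential_def[of 0])
  show "source_basis $$ (?p i, i) dvd 1" if "i < Suc (Suc r)" for i
    using that potential_1 by (auto simp: source_basis_def)
qed (simp add: source_basis_def)

lemma invertible_target_basis: "invertible_mat target_basis"
proof (rule invertible_mat_if_triangular_permuted)
  \<comment> \<open>The row order u_1, ..., u_k, c gives a lower triangular matrix: the column of
    u_{j+2} starts at its left neighbour u_{j+1} with entry -1, as path edges are simple.\<close>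
  let ?p = "\<lambda>i. if i < Suc r then Suc i else if i = Suc r then 0 else i"
  show "?p permutes {0..<Suc (Suc r)}"
    by (rule inj_imp_permutes) (auto simp: inj_on_def split: if_splits)
  show "(\<forall>i j. i < j \<longrightarrow> j < Suc (Suc r) \<longrightarrow> target_basis $$ (?p i, j) = 0) \<or>
      (\<forall>i j. j < i \<longrightarrow> i < Suc (Suc r) \<longrightarrow> target_basis $$ (?p i, j) = 0)"
    by (rule disjI1) (auto simp: target_basis_def laplacian_path_index)
  show "target_basis $$ (?p i, i) dvd 1" if "i < Suc (Suc r)" for i
    using that by (auto simp: target_basis_def laplacian_path_index)
qed (simp add: target_basis_def)

text \<open>The transformations are the inverse of \<open>target_basis\<close> on the left and
  \<open>source_basis\<close> on the right.\<close>

lemma smith_normal_form_laplacian: "smith_normal_form_of L smith_mat"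
proof -
  let ?N = "Suc (Suc r)"
  have c: "source_basis \<in> carrier_mat ?N ?N" "target_basis \<in> carrier_mat ?N ?N"
    "smith_mat \<in> carrier_mat ?N ?N"
    by (simp_all add: source_basis_def target_basis_def smith_mat_def)
  obtain P where P: "P \<in> carrier_mat ?N ?N" "target_basis * P = 1\<^sub>m ?N" "P * target_basis = 1\<^sub>m ?N"
    using invertible_mat_obtain c(2) invertible_target_basis .
  have "P * L * source_basis = P * (L * source_basis)"
    using P(1) laplacian_carrier c(1) by (rule assoc_mult_mat)
  also have "\<dots> = (P * target_basis) * smith_mat"
    unfolding laplacian_mult_source_basis using P(1) c(2,3) by (rule assoc_mult_mat[symmetric])
  finally have eq: "smith_mat = P * L * source_basis" using P(3) c(3) by simp
  have inv: "invertible_mat P"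
    using P c(2) unfolding invertible_mat_def inverts_mat_def
    by (intro conjI exI[of _ target_basis]) auto
  show ?thesis
    unfolding smith_normal_form_of_def
  proof (intro conjI)
    show "\<exists>P Q. P \<in> carrier_mat (dim_row L) (dim_row L) \<and> invertible_mat P \<and>
        Q \<in> carrier_mat (dim_col L) (dim_col L) \<and> invertible_mat Q \<and> smith_mat = P * L * Q"
      using laplacian_carrier P(1) c(1) invertible_source_basis inv eq
      by (intro exI[of _ P] exI[of _ source_basis]) auto
  qed (auto simp: smith_mat_def diagonal_mat_def elementary_divisor_def)
qed

text \<open>\<open>sandpile_group\<close> uses an arbitrarily chosen Smith normal form, so every one
  must be controlled. Kernel counts modulo \<open>m\<close> carry the diagonal of
  \<open>smith_mat\<close> over to \<open>D\<close>.\<close>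

lemma smith_normal_form_laplacian_unique:
  assumes D: "smith_normal_form_of L D"
  shows "D \<in> carrier_mat (Suc (Suc r)) (Suc (Suc r))" "D $$ (Suc r, Suc r) = 0"
    "\<bar>D $$ (r, r)\<bar> = F n a" "\<And>i. i < r \<Longrightarrow> \<bar>D $$ (i, i)\<bar> = 1"
proof -
  let ?N = "Suc (Suc r)"
  show Dc: "D \<in> carrier_mat ?N ?N"
    using D laplacian_carrier by (auto simp: smith_normal_form_of_def)
  have count: "(\<Prod>i<?N. gcd (D $$ (i, i)) m) = m * gcd (F n a) m" if m: "m > 0" for m
  proof -
    have "(\<Prod>i<?N. gcd (D $$ (i, i)) m) = int (card (mod_kernel m D))"
      using card_mod_kernel_diagonal[OF Dc _ m] D by (simp add: smith_normal_form_of_def)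
    also have "card (mod_kernel m D) = card (mod_kernel m smith_mat)"
      using card_mod_kernel_smith_normal_form[OF laplacian_carrier _ m] D
        smith_normal_form_laplacian by simp
    also have "int \<dots> = (\<Prod>i<?N. gcd (smith_mat $$ (i, i)) m)"
      by (rule card_mod_kernel_diagonal[OF _ _ m]) (auto simp: smith_mat_def diagonal_mat_def)
    also have "\<dots> = (\<Prod>i<?N. gcd (elementary_divisor i) m)"
      by (intro prod.cong refl) (simp add: smith_mat_def)
    also have "\<dots> = (\<Prod>i<r. gcd (elementary_divisor i) m) * gcd (F n a) m * m"
      using m by (simp add: elementary_divisor_def)
    also have "(\<Prod>i<r. gcd (elementary_divisor i) m) = 1"
      by (intro prod.neutral) (simp add: elementary_divisor_def)
    finally show ?thesis by simp
  qed
  have dvd: "D $$ (i, i) dvd D $$ (Suc i, Suc i)" if "i < Suc r" for i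
    using D Dc that by (auto simp: smith_normal_form_of_def)
  have F: "F n a > 0" using length_ge_2 by (rule F_pos)
  show "D $$ (Suc r, Suc r) = 0" "\<bar>D $$ (r, r)\<bar> = F n a" "\<And>i. i < r \<Longrightarrow> \<bar>D $$ (i, i)\<bar> = 1"
    using divisor_chain_unique[where d = "\<lambda>i. D $$ (i, i)", OF count dvd F] by auto
qed

lemma sandpile_group_chain: "sandpile_group (chain n a) \<cong> integer_mod_group (nat (F n a))"
proof -
  define D where "D = (SOME D. smith_normal_form_of L D)"
  have "smith_normal_form_of L D"
    unfolding D_def using smith_normal_form_laplacian by (rule someI)
  note D = smith_normal_form_laplacian_unique[OF this]
  have F: "F n a > 0" using length_ge_2 by (rule F_pos)
  let ?I = "{i. i < dim_row D \<and> D $$ (i, i) \<noteq> 0}"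
  let ?H = "\<lambda>i. integer_mod_group (nat \<bar>D $$ (i, i)\<bar>)"
  have "sum_group ?I ?H \<cong> ?H r"
  proof (rule sum_group_iso_only_nontrivial)
    show "r \<in> ?I" using D F by auto
    \<comment> \<open>The zero at \<open>Suc r\<close> is excluded from \<open>?I\<close>, and the
      units before \<open>r\<close> give trivial groups.\<close>
    fix i assume "i \<in> ?I" "i \<noteq> r"
    then have "i < r" using D by (auto simp: less_Suc_eq)
    then show "carrier (?H i) = {\<one>\<^bsub>?H i\<^esub>}" using D(4) by (auto simp: carrier_integer_mod_group)
  qed simp
  then show ?thesis
    using D(3) by (simp add: sandpile_group_def Let_def D_def)
qed

end

theorem theorem4:
  fixes n :: nat and a :: "nat \<Rightarrow> int"
  assumes "n \<ge> 1"
    and "\<And>m. 1 \<le> m \<Longrightarrow> m \<le> n \<Longrightarrow> a m \<ge> 2"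
  shows "F n a > 0 \<and> F n a = G n a \<and>
         sandpile_group (chain n a) \<cong> integer_mod_group (nat (F n a)) \<and>
         integer_mod_group (nat (F n a)) \<cong> integer_mod_group (nat (G n a))"
proof -
  interpret cycle_chain n a by unfold_locales (fact assms(2))
  show ?thesis
    using F_pos[of n a] assms(2) F_eq_G[of n a] sandpile_group_chain iso_refl by auto
qed

end
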